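(* A number $S$ is equal to $S(A^{-1})$ for some invertible triangular matrix $A$ (of some size $n\times n$) with all entries in $\{0,1\}$ if and only if $S$ is an integer.
   Context: For a real matrix $X$, $S(X)$ denotes the sum of all entries of $X$. Inverses are taken over the real numbers. *)

theory Defs
  imports Complex_Main "Jordan_Normal_Form.Matrix"
begin

definition triangular_mat :: "'a::zero mat \<Rightarrow> bool" where
  "triangular_mat A \<longleftrightarrow>
     square_mat A \<and> (upper_triangular A \<or> upper_triangular (transpose_mat A))"

end

theory Submission
  imports Defs "Jordan_Normal_Form.Determinant"
begin

text \<open>
  A triangular 0/1 matrix has determinant 0 or 1, so if it is invertible, then its inverse is
  its adjugate, which has integer entries.  Conversely, if \<open>N\<close> is 1 in the first \<open>p\<close> rows
  of columns \<open>p\<close> and \<open>p + 1\<close> (counted from 0) and 0 elsewhere, then \<open>N\<^sup>2 = 0\<close>, so \<open>I + N\<close> is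
  inverted by \<open>I - N\<close>, whose entries add up to \<open>n - 2 p\<close>.  The sizes \<open>n = p + 2 + q\<close> realise
  every integer.
\<close>

text \<open>By the Leibniz formula, a determinant is a signed sum of products of entries.\<close>

lemma det_Ints:
  fixes A :: "'a :: comm_ring_1 mat"
  assumes "A \<in> carrier_mat n n" "elements_mat A \<subseteq> \<int>"
  shows "det A \<in> \<int>"
proof -
  have "A $$ (i, p i) \<in> \<int>" if "p permutes {0..<n}" "i < n" for p i
    using assms that permutes_in_image[OF that(1), of i]
    by (fastforce simp: elements_mat_def)
  then show ?thesis
    unfolding det_def'[OF assms(1)]
    by (intro Ints_sum Ints_mult Ints_prod) (auto simp: sign_def)
qed

text \<open>Up to sign, each cofactor is the determinant of a matrix whose entries all come from
  \<open>A\<close>.\<close>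

lemma elements_mat_adj_mat_Ints:
  fixes A :: "'a :: comm_ring_1 mat"
  assumes A: "A \<in> carrier_mat n n" and "elements_mat A \<subseteq> \<int>"
  shows "elements_mat (adj_mat A) \<subseteq> \<int>"
proof -
  have "cofactor A i j \<in> \<int>" if "i < n" "j < n" for i j
  proof -
    have "elements_mat (mat_delete A i j) \<subseteq> elements_mat A"
      using A that by (auto simp: mat_delete_def intro!: elements_matI[OF A _ _ refl] dest!: elements_matD)
    then have "det (mat_delete A i j) \<in> \<int>"
      using assms by (intro det_Ints[OF mat_delete_carrier[OF A]]) auto
    then show ?thesis
      unfolding cofactor_def by (intro Ints_mult Ints_power) auto
  qed
  then show ?thesis
    using A by (auto simp: elements_mat_def adj_mat_def)
qed

lemma det_triangular_01:
  fixes A :: "'a :: idom mat"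
  assumes A: "A \<in> carrier_mat n n" and "triangular_mat A" "elements_mat A \<subseteq> {0, 1}"
  shows "det A \<in> {0, 1}"
proof -
  \<comment> \<open>Transposition changes neither the determinant nor the diagonal, so the lower
    triangular case reduces to the upper one.\<close>
  have "det A = prod_list (diag_mat A)"
    using assms det_upper_triangular[of A n] det_upper_triangular[of "A\<^sup>T" n] det_transpose[OF A]
    by (auto simp: triangular_mat_def diag_mat_def intro!: arg_cong[where f = prod_list])
  moreover have "set (diag_mat A) \<subseteq> {0, 1}"
    using assms by (auto simp: diag_mat_def elements_mat_def)
  moreover have "set xs \<subseteq> {0, 1} \<Longrightarrow> prod_list xs \<in> {0, 1}" for xs :: "'a list"
    by (induction xs) auto
  ultimately show ?thesis by metis
qed

lemma sum_mat_inverse_triangular_01_Ints: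
  fixes A B :: "'a :: idom mat"
  assumes A: "A \<in> carrier_mat n n" and B: "B \<in> carrier_mat n n"
    and tri: "triangular_mat A" and el: "elements_mat A \<subseteq> {0, 1}"
    and inv: "inverts_mat A B"
  shows "sum_mat B \<in> \<int>"
proof -
  have AB: "A * B = 1\<^sub>m n"
    using inv A by (simp add: inverts_mat_def)
  have "det A * det B = 1"
    using det_mult[OF A B] AB by simp
  then have det: "det A = 1"
    using det_triangular_01[OF A tri el] by auto
  have adj: "adj_mat A \<in> carrier_mat n n" "adj_mat A * A = 1\<^sub>m n"
    using adj_mat[OF A] det by auto
  \<comment> \<open>The left inverse \<open>adj_mat A\<close> and the right inverse \<open>B\<close>
    of \<open>A\<close> coincide by associativity.\<close>
  have "B = adj_mat A * A * B"
    using adj B by simp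
  also have "\<dots> = adj_mat A"
    using assoc_mult_mat[OF adj(1) A B] AB adj by simp
  finally have "B = adj_mat A" .
  moreover have "{0, 1} \<subseteq> (\<int> :: 'a set)"
    by simp
  then have "elements_mat (adj_mat A) \<subseteq> \<int>"
    using elements_mat_adj_mat_Ints[OF A] el by (meson order_trans)
  ultimately have "elements_mat B \<subseteq> \<int>"
    by simp
  then show ?thesis
    unfolding sum_mat_def by (intro Ints_sum) (auto simp: elements_mat_def)
qed

text \<open>There are two columns of ones so that each of the \<open>p\<close> rows lowers the entry
  sum of the inverse by 2. A single column inside the matrix would give \<open>n - p > 0\<close>,
  whereas \<open>n - 2 * p\<close> also reaches 0 and the negative integers.\<close>

definition block_ones :: "nat \<Rightarrow> nat \<Rightarrow> 'a :: comm_ring_1 mat" where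
  "block_ones n p = mat n n (\<lambda>(i, j). of_bool (i < p \<and> (j = p \<or> j = Suc p)))"

lemma block_ones_carrier [simp]: "block_ones n p \<in> carrier_mat n n"
  by (simp add: block_ones_def)

text \<open>A nonzero entry has row index below \<open>p\<close> and column index at least
  \<open>p\<close>, so every summand of each scalar product vanishes.\<close>

lemma block_ones_square: "block_ones n p * block_ones n p = 0\<^sub>m n n"
  by (rule eq_matI)
    (auto simp: block_ones_def scalar_prod_def simp del: sum_of_bool_mult_eq sum_mult_of_bool_eq
      intro!: sum.neutral)

lemma inverts_mat_square_zero:
  fixes N :: "'a :: comm_ring_1 mat"
  assumes N: "N \<in> carrier_mat n n" and sq: "N * N = 0\<^sub>m n n"
  shows "inverts_mat (1\<^sub>m n + N) (1\<^sub>m n - N)" "inverts_mat (1\<^sub>m n - N) (1\<^sub>m n + N)"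
proof -
  have "(1\<^sub>m n + N) * (1\<^sub>m n - N) = 1\<^sub>m n * (1\<^sub>m n - N) + N * (1\<^sub>m n - N)"
    using N by (intro add_mult_distrib_mat) (auto intro: minus_carrier_mat)
  also have "\<dots> = (1\<^sub>m n - N) + (N - N * N)"
    using N mult_minus_distrib_mat[OF N one_carrier_mat N]
    by (simp add: left_mult_one_mat[OF minus_carrier_mat])
  also have "\<dots> = 1\<^sub>m n"
    using N unfolding sq by (intro eq_matI) auto
  finally show "inverts_mat (1\<^sub>m n + N) (1\<^sub>m n - N)"
    using N by (simp add: inverts_mat_def)
  have "(1\<^sub>m n - N) * (1\<^sub>m n + N) = 1\<^sub>m n * (1\<^sub>m n + N) - N * (1\<^sub>m n + N)"
    using N by (intro minus_mult_distrib_mat) auto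
  also have "\<dots> = (1\<^sub>m n + N) - (N + N * N)"
    using N mult_add_distrib_mat[OF N one_carrier_mat N] by simp
  also have "\<dots> = 1\<^sub>m n"
    using N unfolding sq by (intro eq_matI) auto
  finally show "inverts_mat (1\<^sub>m n - N) (1\<^sub>m n + N)"
    using N by (simp add: inverts_mat_def)
qed

lemma sum_mat_one_minus_block_ones:
  assumes "p + 2 \<le> n"
  shows "sum_mat (1\<^sub>m n - block_ones n p :: 'a :: comm_ring_1 mat) = of_nat n - 2 * of_nat p"
proof -
  have "sum_mat (1\<^sub>m n - block_ones n p :: 'a mat) =
      (\<Sum>i<n. \<Sum>j<n. of_bool (i = j) - of_bool (i < p) * of_bool (j \<in> {p, Suc p}))"
    unfolding sum_mat_def sum.cartesian_product
    by (intro sum.cong) (auto simp: block_ones_def)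
  also have "\<dots> = (\<Sum>i<n. 1 - of_bool (i < p) * 2)"
  proof (rule sum.cong)
    fix i assume "i \<in> {..<n}"
    \<comment> \<open>The bound \<open>p + 2 \<le> n\<close> keeps both columns of ones inside the
      matrix.\<close>
    moreover have "{..<n} \<inter> {j. j \<in> {p, Suc p}} = {p, Suc p}"
      using assms by auto
    then have "(\<Sum>j<n. of_bool (j \<in> {p, Suc p})) = (2 :: 'a)"
      by (subst sum_of_bool_eq) (simp_all only: finite_lessThan, simp)
    ultimately show "(\<Sum>j<n. of_bool (i = j) - of_bool (i < p) * of_bool (j \<in> {p, Suc p})) =
        (1 - of_bool (i < p) * 2 :: 'a)"
      by (simp add: sum_subtractf del: insert_iff flip: sum_distrib_left)
  qed simp
  also have "\<dots> = of_nat n - 2 * of_nat p"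
  proof -
    have "{..<n} \<inter> {i. i < p} = {..<p}"
      using assms by auto
    then show ?thesis
      by (simp add: sum_subtractf flip: sum_distrib_right)
  qed
  finally show ?thesis .
qed

theorem corollary2p4:
  fixes S :: real
  shows "(\<exists>(n::nat) (A::real mat) (B::real mat).
            n \<ge> 1 \<and> A \<in> carrier_mat n n \<and> triangular_mat A \<and>
            elements_mat A \<subseteq> {0, 1} \<and>
            B \<in> carrier_mat n n \<and> inverts_mat A B \<and> inverts_mat B A \<and>
            S = sum_mat B)
         \<longleftrightarrow> S \<in> \<int>"
proof
  assume "S \<in> \<int>"
  then obtain k where k: "S = of_int k"
    by (elim Ints_cases)
  \<comment> \<open>The entry sum will be \<open>n - 2 * p = 2 + q - p\<close> with
    \<open>q = nat (k - 2)\<close>. Choosing \<open>q\<close> and \<open>p\<close> as the positive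
    and negative parts of \<open>k - 2\<close> makes it equal to \<open>k\<close>.\<close>
  define p where "p = nat (2 - k)"
  define n where "n = p + 2 + nat (k - 2)"
  let ?N = "block_ones n p :: real mat"
  have "1\<^sub>m n + ?N \<in> carrier_mat n n" "1\<^sub>m n - ?N \<in> carrier_mat n n"
    by (auto intro: minus_carrier_mat)
  \<comment> \<open>The ones of \<open>?N\<close> lie strictly above the diagonal, since their row
    index is below \<open>p\<close> and their column index is not. So the sum is upper triangular,
    and no entry becomes 2.\<close>
  moreover have "triangular_mat (1\<^sub>m n + ?N)"
    by (auto simp: triangular_mat_def upper_triangular_def block_ones_def)
  moreover have "elements_mat (1\<^sub>m n + ?N) \<subseteq> {0, 1}"
    by (auto simp: elements_mat_def block_ones_def)
  moreover have "inverts_mat (1\<^sub>m n + ?N) (1\<^sub>m n - ?N)" "inverts_mat (1\<^sub>m n - ?N) (1\<^sub>m n + ?N)"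
    by (intro inverts_mat_square_zero block_ones_carrier block_ones_square)+
  moreover have "S = sum_mat (1\<^sub>m n - ?N)"
    by (subst sum_mat_one_minus_block_ones) (auto simp: k n_def p_def)
  moreover have "n \<ge> 1"
    by (simp add: n_def)
  ultimately show "\<exists>(n::nat) (A::real mat) (B::real mat).
            n \<ge> 1 \<and> A \<in> carrier_mat n n \<and> triangular_mat A \<and>
            elements_mat A \<subseteq> {0, 1} \<and>
            B \<in> carrier_mat n n \<and> inverts_mat A B \<and> inverts_mat B A \<and>
            S = sum_mat B"
    by blast
qed (blast intro: sum_mat_inverse_triangular_01_Ints)

end
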